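(* Let $p,q>1$ satisfy $\frac1p+\frac1q=1$, and let $f\in\mathcal E^p$ and $g\in\mathcal E^q$. Suppose that there exist constants $C>0$ and $\rho>0$ such that $$L_f^{(p)}(N)\le C2^{-\rho N},\qquad N\ge0.$$ Then the Faber--Schauder integral satisfies $I_{f,g}\in\mathcal E^q$.
   Context: $C([0,1])$ denotes the real-valued continuous functions on $[0,1]$, $\|\cdot\|_\infty$ the uniform norm. $\mathbb N_0=\{0,1,2,\dots\}$, $\mathbb N_{-1}=\{-1,0,1,\dots\}$. For $n\in\mathbb N_0$: $t_{n,k}=k2^{-n}$ for $0\le k\le 2^n$, $\mathbb T_n=\{t_{n,k}:0\le k\le 2^n\}$, $\mathbb T=\bigcup_{n\ge0}\mathbb T_n$, $I_n=\{0,\dots,2^n-1\}$; for $t\in\mathbb T$, $\ell(t)=\min\{m\ge0:t\in\mathbb T_m\}$. Dyadic left sums: for $f,g\in C([0,1])$, $t\in\mathbb T$, $n\ge\ell(t)$, $$S_n^L(t;f,g)=\sum_{k=0}^{2^nt-1}f(t_{n,k})\big(g(t_{n,k+1})-g(t_{n,k})\big)$$ (empty sum $=0$). The dyadic integral over $[0,t]$ exists if $(S_n^L(t;f,g))_{n\ge\ell(t)}$ converges, and its limit is denoted $I^{\mathbb T}_{f,g}(t)$. Faber--Schauder integral: if $I^{\mathbb T}_{f,g}(t)$ exists for every $t\in\mathbb T$ and the map $I^{\mathbb T}_{f,g}:\mathbb T\to\mathbb R$ admits a (necessarily unique) continuous extension to $[0,1]$, this extension is denoted $I_{f,g}:[0,1]\to\mathbb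 R$ and one says that the Faber--Schauder integral $I_{f,g}$ exists on $[0,1]$. (It exists when $f\in\mathcal E^p$, $g\in\mathcal E^q$ with $\frac1p+\frac1q=1$.) Faber--Schauder coefficients of $f\in C([0,1])$: $\theta^f_{-1,0}=f(1)-f(0)$, and for $n\ge0$, $k\in I_n$, $\theta^f_{n,k}=2^{n/2}\big(2f(t_{n+1,2k+1})-f(t_{n,k})-f(t_{n,k+1})\big)$. Level energies ($p>1$): $\zeta_f^{(p)}(-1)=2^{1-\frac1p}|\theta^f_{-1,0}|$ and $\zeta_f^{(p)}(n)=\big(2^{-np/2}\sum_{k\in I_n}|\theta^f_{n,k}|^p\big)^{1/p}$ for $n\ge0$. Schauder tail sequence: $H_f(n)=\sum_{m=n}^\infty 2^{-m/2}\sup_{k\in I_m}|\theta^f_{m,k}|\in[0,\infty]$ for $n\ge0$. Energy space ($p>1$): $\|f\|_{\mathcal E^p}=\|f\|_\infty+\|\zeta_f^{(p)}\|_{\ell^p(\mathbb N_{-1})}+\|H_f\|_{\ell^p(\mathbb N_0)}$ and $\mathcal E^p=\{f\in C([0,1]):\|f\|_{\mathcal E^p}<\infty\}$. For $r>1$ and $h\in\mathcal E^r$: $\mathcal A_h^{(r)}(n)=\sum_{m=-1}^n 2^{-(n-m)(1-\frac1r)}\zeta_h^{(r)}(m)$ for $n\ge0$, and $$L_h^{(r)}(N)=\|\mathcal A_h^{(r)}\|_{\ell^r_{\ge N}}+\tfrac12\|H_h\|_{\ell^r_{\ge N}},\qquad \|a\|_{\ell^r_{\ge N}}:=\Big(\sum_{n=N}^\infty|a_n|^r\Big)^{1/r},\qquad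 N\ge0.$$ *)

theory Defs
  imports "HOL-Analysis.Analysis"
begin

text \<open>
  A function in \<open>C([0,1])\<close> is rendered as a function \<open>real \<Rightarrow> real\<close> that is continuous on \<open>{0..1}\<close>;
  no definition below looks at its values outside the unit interval.
\<close>

definition dyadic_point :: "nat \<Rightarrow> nat \<Rightarrow> real" where
  "dyadic_point n k = real k / 2 ^ n"

definition dyadic_grid :: "nat \<Rightarrow> real set" where
  "dyadic_grid n = dyadic_point n ` {0..2 ^ n}"

definition dyadics :: "real set" where
  "dyadics = (\<Union>n. dyadic_grid n)"

definition dyadic_level :: "real \<Rightarrow> nat" where
  "dyadic_level t = (LEAST m. t \<in> dyadic_grid m)"


subsection \<open>The Faber--Schauder integral\<close>

text \<open>For \<open>t \<in> dyadic_grid n\<close> the number \<open>2 ^ n * t\<close> is a natural number, so the floor is exact.\<close>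

definition dyadic_left_sum :: "nat \<Rightarrow> real \<Rightarrow> (real \<Rightarrow> real) \<Rightarrow> (real \<Rightarrow> real) \<Rightarrow> real" where
  "dyadic_left_sum n t f g =
     (\<Sum>k<nat \<lfloor>2 ^ n * t\<rfloor>. f (dyadic_point n k) * (g (dyadic_point n (k + 1)) - g (dyadic_point n k)))"

text \<open>The shift by \<open>dyadic_level t\<close> makes the sequence run over \<open>n \<ge> dyadic_level t\<close> only.\<close>

definition dyadic_integral_exists :: "(real \<Rightarrow> real) \<Rightarrow> (real \<Rightarrow> real) \<Rightarrow> real \<Rightarrow> bool" where
  "dyadic_integral_exists f g t \<longleftrightarrow> convergent (\<lambda>j. dyadic_left_sum (dyadic_level t + j) t f g)"

definition dyadic_integral :: "(real \<Rightarrow> real) \<Rightarrow> (real \<Rightarrow> real) \<Rightarrow> real \<Rightarrow> real" where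
  "dyadic_integral f g t = lim (\<lambda>j. dyadic_left_sum (dyadic_level t + j) t f g)"

definition faber_schauder_integral_exists :: "(real \<Rightarrow> real) \<Rightarrow> (real \<Rightarrow> real) \<Rightarrow> bool" where
  "faber_schauder_integral_exists f g \<longleftrightarrow>
     (\<forall>t\<in>dyadics. dyadic_integral_exists f g t) \<and>
     (\<exists>F. continuous_on {0..1} F \<and> (\<forall>t\<in>dyadics. F t = dyadic_integral f g t))"

text \<open>
  The continuous extension is unique on \<open>{0..1}\<close> only; requiring it to be \<^const>\<open>extensional\<close> pins it
  down as a function on the whole real line.
\<close>

definition faber_schauder_integral :: "(real \<Rightarrow> real) \<Rightarrow> (real \<Rightarrow> real) \<Rightarrow> real \<Rightarrow> real" where
  "faber_schauder_integral f g =
     (THE F. continuous_on {0..1} F \<and> F \<in> extensional {0..1} \<and>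
             (\<forall>t\<in>dyadics. F t = dyadic_integral f g t))"


subsection \<open>Faber--Schauder coefficients, level energies and Schauder tails\<close>

text \<open>
  Levels are integers so that the level \<open>-1\<close> (the affine part, with the single index \<open>k = 0\<close>)
  is available; the values at levels below \<open>-1\<close> are never used.
\<close>

definition fs_coeff :: "(real \<Rightarrow> real) \<Rightarrow> int \<Rightarrow> nat \<Rightarrow> real" where
  "fs_coeff f n k =
     (if n = -1 then f 1 - f 0
      else 2 powr (of_int n / 2) *
        (2 * f (dyadic_point (nat n + 1) (2 * k + 1))
           - f (dyadic_point (nat n) k) - f (dyadic_point (nat n) (k + 1))))"

definition level_energy :: "real \<Rightarrow> (real \<Rightarrow> real) \<Rightarrow> int \<Rightarrow> real" where
  "level_energy p f n =
     (if n = -1 then 2 powr (1 - 1 / p) * \<bar>fs_coeff f (-1) 0\<bar>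
      else (2 powr (- of_int n * p / 2) * (\<Sum>k<2 ^ nat n. \<bar>fs_coeff f n k\<bar> powr p)) powr (1 / p))"

definition schauder_tail :: "(real \<Rightarrow> real) \<Rightarrow> nat \<Rightarrow> ennreal" where
  "schauder_tail f n =
     (\<Sum>\<^sub>\<infinity>m\<in>{n..}. ennreal (2 powr (- real m / 2) * (SUP k\<in>{..<2 ^ m}. \<bar>fs_coeff f (int m) k\<bar>)))"


subsection \<open>The energy space\<close>

text \<open>Only meant for exponents \<open>r > 0\<close>.\<close>

definition ennreal_powr :: "ennreal \<Rightarrow> real \<Rightarrow> ennreal" where
  "ennreal_powr x r = (if x = \<infinity> then \<infinity> else ennreal (enn2real x powr r))"

definition lp_norm_on :: "real \<Rightarrow> 'i set \<Rightarrow> ('i \<Rightarrow> ennreal) \<Rightarrow> ennreal" where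
  "lp_norm_on p J a = ennreal_powr (\<Sum>\<^sub>\<infinity>n\<in>J. ennreal_powr (a n) p) (1 / p)"

definition energy_norm :: "real \<Rightarrow> (real \<Rightarrow> real) \<Rightarrow> ennreal" where
  "energy_norm p f =
     (SUP x\<in>{0..1}. ennreal \<bar>f x\<bar>)
     + lp_norm_on p {-1..} (\<lambda>n. ennreal (level_energy p f n))
     + lp_norm_on p {0..} (schauder_tail f)"

definition energy_space :: "real \<Rightarrow> (real \<Rightarrow> real) set" where
  "energy_space p = {f. continuous_on {0..1} f \<and> energy_norm p f < \<infinity>}"


subsection \<open>Accumulated energies and the tail functional\<close>

definition accumulated_energy :: "real \<Rightarrow> (real \<Rightarrow> real) \<Rightarrow> nat \<Rightarrow> real" where
  "accumulated_energy r h n =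
     (\<Sum>m=-1..int n. 2 powr (- of_int (int n - m) * (1 - 1 / r)) * level_energy r h m)"

definition tail_functional :: "real \<Rightarrow> (real \<Rightarrow> real) \<Rightarrow> nat \<Rightarrow> ennreal" where
  "tail_functional r h N =
     lp_norm_on r {N..} (\<lambda>n. ennreal (accumulated_energy r h n))
     + ennreal (1 / 2) * lp_norm_on r {N..} (schauder_tail h)"

end

theory Submission
  imports Defs
begin

text \<open>
  Everything is read off from increments on the dyadic grids.  Write \<open>t_k\<close> for the grid points of
  level \<open>n\<close>.  Passing from level \<open>n\<close> to level \<open>n + 1\<close> changes the left sum by
  \<open>\<Sum> (f(m_k) - f(t_k)) * (g(t_{k+1}) - g(m_k))\<close>, where \<open>m_k\<close> is the midpoint of the cell
  \<open>[t_k, t_{k+1}]\<close>.  By Hoelder this is at most the product of the \<open>\<ell>\<^sup>p\<close> norm of the increments of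
  \<open>f\<close> and the \<open>\<ell>\<^sup>q\<close> norm of the increments of \<open>g\<close> at level \<open>n + 1\<close>
  (\<open>refinement_error_le\<close>).

  Halving a cell turns an increment \<open>d\<close> into \<open>(d \<plusminus> e) / 2\<close>, with \<open>e\<close> the rescaled
  Faber--Schauder coefficient, so Minkowski bounds the norm of the increments at level \<open>n + 1\<close> by
  the accumulated energy at level \<open>n\<close> (\<open>grid_norm_le_accumulated_energy\<close>).  For \<open>f\<close> the
  hypothesis on the tail functional makes this decay like \<open>2 powr (- \<rho> * n)\<close>; for \<open>g\<close> it stays
  bounded.  Hence the changes of the left sums decay geometrically.

  To obtain a continuous limit at once, the left sums are interpolated: \<open>step_integral f g n x\<close>
  is the integral over \<open>[0, x]\<close> of the level-\<open>n\<close> step function of \<open>f\<close> against \<open>g\<close>.  It is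
  continuous in \<open>x\<close>, it equals the left sum at grid points, and consecutive ones differ
  uniformly by a geometrically small amount.  Their uniform limit \<open>F\<close> is the
  Faber--Schauder integral (\<open>step_integral_uniform_limit\<close>, \<open>faber_schauder_integral_eqI\<close>).

  For the energies of \<open>F\<close>, note that on a cell of level \<open>n\<close> the step integral is \<open>f(t_k) * g\<close> up to
  a constant, so its second difference there is exactly \<open>f(t_k)\<close> times that of \<open>g\<close>.  The remainder
  \<open>F - step_integral f g n\<close> has variation along the grid of level \<open>n + 1\<close> at most the sum of
  the refinement errors from level \<open>n\<close> on, because variation along a grid only grows under
  refinement.  So the second differences of \<open>F\<close> differ from \<open>f(t_k)\<close> times those of
  \<open>g\<close> by an amount that, summed over all cells of level \<open>n\<close>, is geometrically small
  (\<open>sum_abs_second_difference_integral\<close>).  Level energies and Schauder tails are norms of second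
  differences; at levels \<open>n \<ge> 0\<close> those of \<open>F\<close> are therefore at most \<open>sup \<bar>f\<bar>\<close> times those of \<open>g\<close>
  plus a geometric sequence, and membership in the energy space passes from \<open>g\<close> to \<open>F\<close>
  (\<open>energy_spaceI_second_difference\<close>).
\<close>

section \<open>The Minkowski and Hoelder inequalities for finite sums\<close>

definition lp_sum :: "real \<Rightarrow> 'i set \<Rightarrow> ('i \<Rightarrow> real) \<Rightarrow> real" where
  "lp_sum p A u = (\<Sum>i\<in>A. \<bar>u i\<bar> powr p) powr (1 / p)"

lemma powr_le_cancel_base:
  fixes x y p :: real
  assumes "x powr p \<le> y powr p" "p > 0" "0 \<le> y"
  shows "x \<le> y"
proof (rule ccontr)
  assume "\<not> x \<le> y"
  then have "y powr p < x powr p"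
    using assms by (intro powr_less_mono2) auto
  then show False
    using assms by simp
qed

lemma lp_sum_nonneg [simp]: "0 \<le> lp_sum p A u"
  by (simp add: lp_sum_def)

lemma lp_sum_powr:
  assumes "p > 0"
  shows "lp_sum p A u powr p = (\<Sum>i\<in>A. \<bar>u i\<bar> powr p)"
  using assms by (simp add: lp_sum_def powr_powr sum_nonneg)

lemma abs_le_lp_sum:
  assumes "p > 0" "finite A" "i \<in> A"
  shows "\<bar>u i\<bar> \<le> lp_sum p A u"
proof -
  have "\<bar>u i\<bar> powr p \<le> lp_sum p A u powr p"
    unfolding lp_sum_powr[OF assms(1)] using assms
    by (intro member_le_sum) auto
  then show ?thesis
    using assms(1) by (rule powr_le_cancel_base) simp
qed

lemma lp_sum_mono:
  assumes "p > 0" "\<And>i. i \<in> A \<Longrightarrow> \<bar>u i\<bar> \<le> \<bar>v i\<bar>"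
  shows "lp_sum p A u \<le> lp_sum p A v"
  unfolding lp_sum_def using assms
  by (intro powr_mono2 sum_mono sum_nonneg) auto

lemma lp_sum_scale:
  assumes "p > 0"
  shows "lp_sum p A (\<lambda>i. c * u i) = \<bar>c\<bar> * lp_sum p A u"
  using assms
  by (simp add: lp_sum_def abs_mult powr_mult sum_nonneg powr_powr flip: sum_distrib_left)

lemma lp_sum_eq_0_imp:
  assumes "p > 0" "finite A" "i \<in> A" "lp_sum p A u = 0"
  shows "u i = 0"
  using abs_le_lp_sum[of p A i u] assms by simp

lemma powr_convex_combination:
  fixes x y s p :: real
  assumes "p \<ge> 1" "0 \<le> s" "s \<le> 1" "0 \<le> x" "0 \<le> y"
  shows "(s * x + (1 - s) * y) powr p \<le> s * x powr p + (1 - s) * y powr p"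
proof -
  have shrink: "c powr p \<le> c" if "0 \<le> c" "c \<le> 1" for c :: real
    using powr_mono'[of 1 p c] that assms(1) by simp
  consider "x = 0" | "y = 0" | "x > 0" "y > 0"
    using assms by linarith
  then show ?thesis
  proof cases
    case 1
    then show ?thesis
      using assms shrink[of "1 - s"] by (simp add: powr_mult mult_right_mono)
  next
    case 2
    then show ?thesis
      using assms shrink[of s] by (simp add: powr_mult mult_right_mono)
  next
    case 3
    then show ?thesis
      using convex_onD[OF powr_convex[OF assms(1)], of "1 - s" x y] assms by simp
  qed
qed

text \<open>
  With \<open>a\<close>, \<open>b\<close> the two norms and \<open>s = a / (a + b)\<close>, the sum of moduli divided by \<open>a + b\<close> is the
  convex combination, with weights \<open>s\<close> and \<open>1 - s\<close>, of \<open>\<bar>u i\<bar> / a\<close> and \<open>\<bar>v i\<bar> / b\<close>, both of norm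
  one; convexity of the \<open>p\<close>-th power keeps the norm at most one.
\<close>

theorem minkowski_lp_sum:
  assumes "p \<ge> 1" "finite A"
  shows "lp_sum p A (\<lambda>i. u i + v i) \<le> lp_sum p A u + lp_sum p A v"
proof -
  define a b where "a = lp_sum p A u" and "b = lp_sum p A v"
  have p: "p > 0" using assms by simp
  have sums: "(\<Sum>i\<in>A. \<bar>u i\<bar> powr p) = a powr p" "(\<Sum>i\<in>A. \<bar>v i\<bar> powr p) = b powr p"
    unfolding a_def b_def lp_sum_powr[OF p] by (rule refl)+
  have nn: "0 \<le> a" "0 \<le> b" by (auto simp: a_def b_def)
  consider "a = 0" | "b = 0" | "a > 0" "b > 0" using nn by linarith
  then show ?thesis
  proof cases
    case 1
    then have "\<And>i. i \<in> A \<Longrightarrow> u i = 0"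
      using lp_sum_eq_0_imp[OF p assms(2)] by (simp add: a_def)
    then have "lp_sum p A (\<lambda>i. u i + v i) = b"
      by (simp add: lp_sum_def b_def)
    then show ?thesis using nn by (simp add: a_def b_def)
  next
    case 2
    then have "\<And>i. i \<in> A \<Longrightarrow> v i = 0"
      using lp_sum_eq_0_imp[OF p assms(2)] by (simp add: b_def)
    then have "lp_sum p A (\<lambda>i. u i + v i) = a"
      by (simp add: lp_sum_def a_def)
    then show ?thesis using nn by (simp add: a_def b_def)
  next
    case 3
    define s where "s = a / (a + b)"
    have s: "0 \<le> s" "s \<le> 1" "1 - s = b / (a + b)"
      using 3 by (auto simp: s_def field_simps)
    have term_le: "\<bar>u i + v i\<bar> powr p
        \<le> (a + b) powr p * (s * (\<bar>u i\<bar> powr p / a powr p) + (1 - s) * (\<bar>v i\<bar> powr p / b powr p))" for i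
    proof -
      have split: "\<bar>u i\<bar> + \<bar>v i\<bar> = (a + b) * (s * (\<bar>u i\<bar> / a) + (1 - s) * (\<bar>v i\<bar> / b))"
        using 3 unfolding s(3) by (simp add: s_def distrib_left)
      have "\<bar>u i + v i\<bar> powr p \<le> (\<bar>u i\<bar> + \<bar>v i\<bar>) powr p"
        using p by (intro powr_mono2) auto
      also have "\<dots> = (a + b) powr p * (s * (\<bar>u i\<bar> / a) + (1 - s) * (\<bar>v i\<bar> / b)) powr p"
        unfolding split using 3 s(1,2) by (subst powr_mult) auto
      also have "\<dots> \<le> (a + b) powr p * (s * (\<bar>u i\<bar> / a) powr p + (1 - s) * (\<bar>v i\<bar> / b) powr p)"
        using assms s 3 by (intro mult_left_mono powr_convex_combination) auto
      finally show ?thesis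
        using 3 by (simp add: powr_divide)
    qed
    have "lp_sum p A (\<lambda>i. u i + v i) powr p
        \<le> (\<Sum>i\<in>A. (a + b) powr p * (s * (\<bar>u i\<bar> powr p / a powr p) + (1 - s) * (\<bar>v i\<bar> powr p / b powr p)))"
      unfolding lp_sum_powr[OF p] by (intro sum_mono term_le)
    also have "\<dots> = (a + b) powr p * (s * ((\<Sum>i\<in>A. \<bar>u i\<bar> powr p) / a powr p)
        + (1 - s) * ((\<Sum>i\<in>A. \<bar>v i\<bar> powr p) / b powr p))"
      by (simp only: sum.distrib flip: sum_divide_distrib sum_distrib_left)
    also have "\<dots> = (a + b) powr p"
      using 3 unfolding sums by simp
    finally have "lp_sum p A (\<lambda>i. u i + v i) \<le> a + b"
      by (rule powr_le_cancel_base) (use p 3 in auto)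
    then show ?thesis by (simp add: a_def b_def)
  qed
qed

text \<open>
  Young's inequality, applied after both factors are normalised to norm one.
\<close>

theorem holder_lp_sum:
  assumes "p > 1" "q > 1" "1 / p + 1 / q = 1" "finite A"
  shows "(\<Sum>i\<in>A. \<bar>u i * v i\<bar>) \<le> lp_sum p A u * lp_sum q A v"
proof -
  define a b where "a = lp_sum p A u" and "b = lp_sum q A v"
  have p: "p > 0" "q > 0" using assms by simp_all
  have sums: "(\<Sum>i\<in>A. \<bar>u i\<bar> powr p) = a powr p" "(\<Sum>i\<in>A. \<bar>v i\<bar> powr q) = b powr q"
    unfolding a_def b_def lp_sum_powr[OF p(1)] lp_sum_powr[OF p(2)] by (rule refl)+
  have nn: "0 \<le> a" "0 \<le> b" by (auto simp: a_def b_def)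
  show ?thesis
  proof (cases "a = 0 \<or> b = 0")
    case True
    then have "\<And>i. i \<in> A \<Longrightarrow> u i * v i = 0"
      using lp_sum_eq_0_imp[OF p(1) assms(4), of _ u] lp_sum_eq_0_imp[OF p(2) assms(4), of _ v] by (auto simp: a_def b_def)
    then have "(\<Sum>i\<in>A. \<bar>u i * v i\<bar>) = 0"
      by (intro sum.neutral) auto
    then show ?thesis by (simp add: a_def b_def)
  next
    case False
    then have ab: "a > 0" "b > 0" using nn by auto
    have "\<bar>u i * v i\<bar> \<le> a * b * (\<bar>u i\<bar> powr p / a powr p / p + \<bar>v i\<bar> powr q / b powr q / q)" for i
    proof -
      have "(\<bar>u i\<bar> / a) * (\<bar>v i\<bar> / b) \<le> (\<bar>u i\<bar> / a) powr p / p + (\<bar>v i\<bar> / b) powr q / q"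
        using assms ab by (intro Youngs_inequality) auto
      then have "a * b * ((\<bar>u i\<bar> / a) * (\<bar>v i\<bar> / b))
          \<le> a * b * (\<bar>u i\<bar> powr p / a powr p / p + \<bar>v i\<bar> powr q / b powr q / q)"
        using ab by (intro mult_left_mono) (auto simp: powr_divide)
      then show ?thesis
        using ab by (simp add: abs_mult)
    qed
    then have "(\<Sum>i\<in>A. \<bar>u i * v i\<bar>)
        \<le> (\<Sum>i\<in>A. a * b * (\<bar>u i\<bar> powr p / a powr p / p + \<bar>v i\<bar> powr q / b powr q / q))"
      by (intro sum_mono)
    also have "\<dots> = a * b * ((\<Sum>i\<in>A. \<bar>u i\<bar> powr p) / a powr p / p + (\<Sum>i\<in>A. \<bar>v i\<bar> powr q) / b powr q / q)"
      by (simp only: sum.distrib flip: sum_divide_distrib sum_distrib_left)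
    also have "\<dots> = a * b"
      using ab assms(3) unfolding sums by simp
    finally show ?thesis by (simp add: a_def b_def)
  qed
qed

text \<open>
  Minkowski applied to the splitting of \<open>u\<close> into single entries, whose norm is their modulus.
\<close>

lemma lp_sum_le_sum_abs:
  assumes "p \<ge> 1" "finite A"
  shows "lp_sum p A u \<le> (\<Sum>i\<in>A. \<bar>u i\<bar>)"
  using assms(2)
proof (induction A rule: finite_induct)
  case empty
  then show ?case by (simp add: lp_sum_def)
next
  case (insert x A)
  let ?a = "\<lambda>i. if i = x then u i else 0" and ?b = "\<lambda>i. if i = x then 0 else u i"
  have "lp_sum p (insert x A) u = lp_sum p (insert x A) (\<lambda>i. ?a i + ?b i)"
    by (intro arg_cong[where f = "lp_sum p _"]) auto
  also have "\<dots> \<le> lp_sum p (insert x A) ?a + lp_sum p (insert x A) ?b"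
    using insert assms by (intro minkowski_lp_sum) auto
  also have "lp_sum p (insert x A) ?a = \<bar>u x\<bar>"
  proof -
    have "(\<Sum>i\<in>A. \<bar>?a i\<bar> powr p) = 0"
      using insert by (intro sum.neutral) auto
    then show ?thesis
      using insert assms by (simp add: lp_sum_def powr_powr)
  qed
  also have "lp_sum p (insert x A) ?b = lp_sum p A u"
  proof -
    have "(\<Sum>i\<in>A. \<bar>?b i\<bar> powr p) = (\<Sum>i\<in>A. \<bar>u i\<bar> powr p)"
      using insert by (intro sum.cong) auto
    then show ?thesis
      using insert assms by (simp add: lp_sum_def)
  qed
  finally show ?case
    using insert by simp
qed

section \<open>Increments and second differences on the dyadic grids\<close>

definition increment :: "(real \<Rightarrow> real) \<Rightarrow> nat \<Rightarrow> nat \<Rightarrow> real" where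
  "increment h n k = h (dyadic_point n (k + 1)) - h (dyadic_point n k)"

text \<open>
  This is \<open>2 powr (- n / 2)\<close> times the Faber--Schauder coefficient; dropping the normalisation
  turns level energies and tail terms into plain \<open>\<ell>\<^sup>p\<close> and supremum norms.
\<close>

definition second_difference :: "(real \<Rightarrow> real) \<Rightarrow> nat \<Rightarrow> nat \<Rightarrow> real" where
  "second_difference h n k =
     2 * h (dyadic_point (n + 1) (2 * k + 1)) - h (dyadic_point n k) - h (dyadic_point n (k + 1))"

definition grid_variation :: "(real \<Rightarrow> real) \<Rightarrow> nat \<Rightarrow> real" where
  "grid_variation h n = (\<Sum>k<2 ^ n. \<bar>increment h n k\<bar>)"

lemma dyadic_point_double [simp]: "dyadic_point (Suc n) (2 * k) = dyadic_point n k"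
  by (simp add: dyadic_point_def)

lemma dyadic_point_double_Suc [simp]: "dyadic_point (Suc n) (Suc (Suc (2 * k))) = dyadic_point n (Suc k)"
  by (simp add: dyadic_point_def field_simps)

lemma dyadic_point_le_iff [simp]: "dyadic_point n j \<le> dyadic_point n k \<longleftrightarrow> j \<le> k"
  by (simp add: dyadic_point_def divide_le_cancel)

lemma dyadic_point_0 [simp]: "dyadic_point n 0 = 0"
  by (simp add: dyadic_point_def)

lemma dyadic_point_top [simp]: "dyadic_point n (2 ^ n) = 1"
  by (simp add: dyadic_point_def)

lemma dyadic_point_nonneg [simp]: "0 \<le> dyadic_point n k"
  by (simp add: dyadic_point_def)

lemma dyadic_point_le_1 [simp]: "dyadic_point n k \<le> 1 \<longleftrightarrow> k \<le> 2 ^ n"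
  using dyadic_point_le_iff[of n k "2 ^ n"] by (simp del: dyadic_point_le_iff)

lemma dyadic_cell:
  assumes "x \<in> {0..1}"
  obtains k where "k < 2 ^ n" "dyadic_point n k \<le> x" "x \<le> dyadic_point n (Suc k)"
proof (cases "x = 1")
  case True
  have "dyadic_point n (2 ^ n - 1) \<le> x" "x \<le> dyadic_point n (Suc (2 ^ n - 1))"
    using True by simp_all
  then show ?thesis
    by (intro that[of "2 ^ n - 1"]) auto
next
  case False
  define k where "k = nat \<lfloor>2 ^ n * x\<rfloor>"
  have "0 \<le> 2 ^ n * x" using assms by simp
  then have k: "real k \<le> 2 ^ n * x" "2 ^ n * x < real k + 1"
    unfolding k_def by linarith+
  have "2 ^ n * x < 2 ^ n" using assms False by simp
  then have "real k < 2 ^ n" using k by linarith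
  then have "k < 2 ^ n" by (simp flip: of_nat_less_iff)
  then show ?thesis
    using k by (intro that[of k]) (simp_all add: dyadic_point_def field_simps)
qed

lemma increment_even:
  "increment h (Suc n) (2 * k) = (increment h n k + second_difference h n k) / 2"
  by (simp add: increment_def second_difference_def)

lemma increment_odd:
  "increment h (Suc n) (Suc (2 * k)) = (increment h n k - second_difference h n k) / 2"
  by (simp add: increment_def second_difference_def)

lemma second_difference_eq_increments:
  "second_difference h n k = increment h (Suc n) (2 * k) - increment h (Suc n) (Suc (2 * k))"
  by (simp add: increment_def second_difference_def)

lemma increment_eq_increments:
  "increment h n k = increment h (Suc n) (2 * k) + increment h (Suc n) (Suc (2 * k))"
  by (simp add: increment_def)

lemma sum_lessThan_double:
  fixes F :: "nat \<Rightarrow> real"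
  shows "(\<Sum>j<2 * N. F j) = (\<Sum>k<N. F (2 * k) + F (Suc (2 * k)))"
  by (induction N) (simp_all add: algebra_simps)

lemma increment_sum: "(\<Sum>k<K. increment h n k) = h (dyadic_point n K) - h 0"
  using sum_lessThan_telescope[of "\<lambda>k. h (dyadic_point n k)" K] by (simp add: increment_def)

text \<open>
  Every increment is the sum of the two increments of its half cells.
\<close>

lemma grid_variation_refine: "grid_variation h n \<le> grid_variation h (Suc n)"
  unfolding grid_variation_def power_Suc sum_lessThan_double
  by (intro sum_mono) (simp add: increment_eq_increments[of h n])

lemma grid_variation_mono: "n \<le> m \<Longrightarrow> grid_variation h n \<le> grid_variation h m"
  by (rule lift_Suc_mono_le[of "grid_variation h"]) (rule grid_variation_refine)

lemma grid_variation_add: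
  "grid_variation (\<lambda>x. u x + v x) n \<le> grid_variation u n + grid_variation v n"
  unfolding grid_variation_def sum.distrib[symmetric]
  by (intro sum_mono) (simp add: increment_def)

lemma abs_diff_le_grid_variation:
  assumes "k \<le> 2 ^ n"
  shows "\<bar>h (dyadic_point n k) - h 0\<bar> \<le> grid_variation h n"
proof -
  have "\<bar>h (dyadic_point n k) - h 0\<bar> \<le> (\<Sum>j<k. \<bar>increment h n j\<bar>)"
    unfolding increment_sum[symmetric] by (rule sum_abs)
  also have "\<dots> \<le> grid_variation h n"
    unfolding grid_variation_def using assms by (intro sum_mono2) auto
  finally show ?thesis .
qed

lemma sum_abs_second_difference_le:
  "(\<Sum>k<2 ^ n. \<bar>second_difference h n k\<bar>) \<le> grid_variation h (Suc n)"
  unfolding grid_variation_def power_Suc sum_lessThan_double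
  by (intro sum_mono) (simp add: second_difference_eq_increments)

section \<open>Increments are controlled by level energies\<close>

lemma fs_coeff_eq_second_difference:
  "fs_coeff h (int n) k = 2 powr (real n / 2) * second_difference h n k"
  by (simp add: fs_coeff_def second_difference_def)

lemma level_energy_eq_lp_sum:
  assumes "p > 0"
  shows "level_energy p h (int n) = lp_sum p {..<2 ^ n} (second_difference h n)"
proof -
  have "2 powr (- real n * p / 2) * \<bar>fs_coeff h (int n) k\<bar> powr p = \<bar>second_difference h n k\<bar> powr p" for k
    using assms by (simp add: fs_coeff_eq_second_difference abs_mult powr_mult powr_powr flip: powr_add mult.assoc)
  then show ?thesis
    by (simp add: level_energy_def lp_sum_def sum_distrib_left)
qed

lemma level_energy_nonneg: "0 \<le> level_energy p h n"
  by (simp add: level_energy_def)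

abbreviation grid_norm :: "real \<Rightarrow> (real \<Rightarrow> real) \<Rightarrow> nat \<Rightarrow> real" where
  "grid_norm p h n \<equiv> lp_sum p {..<2 ^ n} (increment h n)"

text \<open>
  Each of the \<open>\<ell>\<^sup>p\<close> vectors (increments and second differences) is halved and has every entry
  repeated twice, up to sign; this multiplies its norm by \<open>2 powr (1 / p) / 2\<close>.  Minkowski combines
  the two.
\<close>

lemma grid_norm_Suc_le:
  assumes "p \<ge> 1"
  shows "grid_norm p h (Suc n) \<le> 2 powr (- (1 - 1 / p)) * (grid_norm p h n + level_energy p h (int n))"
proof -
  have p: "p > 0" using assms by simp
  \<comment> \<open>\<open>j div 2\<close> is the parent of the half cell \<open>j\<close>; the sign in \<open>v\<close> is that of the second difference.\<close>
  define u v :: "nat \<Rightarrow> real" where "u = (\<lambda>j. increment h n (j div 2))"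
    and "v = (\<lambda>j. (if even j then 1 else - 1) * second_difference h n (j div 2))"
  have two: "{..<2 ^ Suc n} = {..<2 * 2 ^ n :: nat}" by simp
  have doubled: "lp_sum p {..<2 ^ Suc n} w = 2 powr (1 / p) * lp_sum p {..<2 ^ n} w'"
    if "\<And>k. \<bar>w (2 * k)\<bar> = \<bar>w' k\<bar>" "\<And>k. \<bar>w (Suc (2 * k))\<bar> = \<bar>w' k\<bar>" for w w' :: "nat \<Rightarrow> real"
    unfolding lp_sum_def two sum_lessThan_double that
    by (simp add: powr_mult sum_nonneg flip: sum_distrib_left mult_2)
  have "increment h (Suc n) j = 1 / 2 * u j + 1 / 2 * v j" for j
    by (cases "even j") (auto elim!: evenE oddE simp: u_def v_def increment_even increment_odd)
  then have "increment h (Suc n) = (\<lambda>j. 1 / 2 * u j + 1 / 2 * v j)"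
    by (rule ext)
  then have "grid_norm p h (Suc n) \<le> lp_sum p {..<2 ^ Suc n} (\<lambda>j. 1 / 2 * u j)
      + lp_sum p {..<2 ^ Suc n} (\<lambda>j. 1 / 2 * v j)"
    using minkowski_lp_sum[OF assms, of "{..<2 ^ Suc n}" "\<lambda>j. 1 / 2 * u j" "\<lambda>j. 1 / 2 * v j"]
    by (simp only: finite_lessThan)
  also have "\<dots> = 1 / 2 * (lp_sum p {..<2 ^ Suc n} u + lp_sum p {..<2 ^ Suc n} v)"
    using lp_sum_scale[OF p, of "{..<2 ^ Suc n}" "1 / 2" u] lp_sum_scale[OF p, of "{..<2 ^ Suc n}" "1 / 2" v] by simp
  also have "lp_sum p {..<2 ^ Suc n} u = 2 powr (1 / p) * grid_norm p h n"
    by (rule doubled) (simp_all add: u_def)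
  also have "lp_sum p {..<2 ^ Suc n} v = 2 powr (1 / p) * level_energy p h (int n)"
    unfolding level_energy_eq_lp_sum[OF p] by (rule doubled) (simp_all add: v_def)
  also have "1 / 2 * (2 powr (1 / p) * grid_norm p h n + 2 powr (1 / p) * level_energy p h (int n))
      = 2 powr (- (1 - 1 / p)) * (grid_norm p h n + level_energy p h (int n))"
    by (simp add: powr_diff distrib_left)
  finally show ?thesis .
qed

lemma accumulated_energy_0:
  "accumulated_energy r h 0 = 2 powr (- (1 - 1 / r)) * level_energy r h (- 1) + level_energy r h 0"
proof -
  have "{-1..0::int} = {-1, 0}" by auto
  then show ?thesis by (simp add: accumulated_energy_def)
qed

text \<open>
  The accumulated energy obeys the same recursion as the bound in \<open>grid_norm_Suc_le\<close>, which is why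
  it dominates the norms of the increments.
\<close>

lemma accumulated_energy_Suc:
  "accumulated_energy r h (Suc n)
     = 2 powr (- (1 - 1 / r)) * accumulated_energy r h n + level_energy r h (int (Suc n))"
proof -
  define c where "c = 1 - 1 / r"
  have levels: "{-1..int (Suc n)} = insert (int (Suc n)) {-1..int n}" by auto
  have decay: "2 powr (- of_int (int (Suc n) - m) * c)
      = 2 powr (- c) * 2 powr (- of_int (int n - m) * c)" for m :: int
    unfolding powr_add[symmetric] by (simp add: algebra_simps)
  show ?thesis
    unfolding accumulated_energy_def c_def[symmetric] levels
    by (subst sum.insert) (simp_all only: decay sum_distrib_left mult.assoc, simp_all add: powr_minus)
qed

lemma grid_norm_le_accumulated_energy:
  assumes "p \<ge> 1"
  shows "grid_norm p h (Suc n) \<le> 2 powr (- (1 - 1 / p)) * accumulated_energy p h n"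
proof (induction n)
  case 0
  have "grid_norm p h 0 = 2 powr (- (1 - 1 / p)) * level_energy p h (- 1)"
    using assms by (simp add: lp_sum_def increment_def powr_powr level_energy_def fs_coeff_def
        dyadic_point_def flip: powr_add mult.assoc)
  then show ?case
    using grid_norm_Suc_le[OF assms, where h = h and n = 0] by (simp add: accumulated_energy_0)
next
  case (Suc n)
  define c where "c = 2 powr (- (1 - 1 / p))"
  have "grid_norm p h (Suc (Suc n)) \<le> c * (grid_norm p h (Suc n) + level_energy p h (int (Suc n)))"
    unfolding c_def by (rule grid_norm_Suc_le[OF assms])
  also have "\<dots> \<le> c * (c * accumulated_energy p h n + level_energy p h (int (Suc n)))"
    using Suc unfolding c_def by (intro mult_left_mono add_right_mono) auto
  finally show ?case
    unfolding accumulated_energy_Suc c_def .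
qed

text \<open>
  The recursion \<open>V (n + 1) \<le> c * (V n + Z)\<close> with \<open>c < 1\<close> cannot leave a sufficiently long
  interval \<open>[0, B]\<close>.
\<close>

lemma grid_norm_bounded:
  assumes p: "p > 1" and Z: "\<And>n. level_energy p h (int n) \<le> Z"
  obtains B where "\<And>n. grid_norm p h n \<le> B"
proof -
  define c where "c = 2 powr (- (1 - 1 / p))"
  have c: "0 < c" "c < 1"
    using p by (auto simp: c_def powr_less_one)
  \<comment> \<open>\<open>Z / (1 - c)\<close> makes \<open>c * (B + Z) \<le> B\<close>, using \<open>c * Z \<le> Z\<close>.\<close>
  define B where "B = max (grid_norm p h 0) (Z / (1 - c))"
  have "grid_norm p h n \<le> B" for n
  proof (induction n)
    case (Suc n)
    have "0 \<le> Z"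
      using level_energy_nonneg Z[of 0] by (rule order_trans)
    then have "c * Z \<le> Z"
      using c mult_right_mono[of c 1 Z] by simp
    also have "\<dots> \<le> B * (1 - c)"
      using c by (simp add: B_def flip: pos_divide_le_eq)
    finally have Z_le: "c * Z \<le> B - c * B"
      by (simp add: algebra_simps)
    have "grid_norm p h (Suc n) \<le> c * (grid_norm p h n + level_energy p h (int n))"
      using p unfolding c_def by (intro grid_norm_Suc_le) simp
    also have "\<dots> \<le> c * (B + Z)"
      using c Suc Z[of n] by (intro mult_left_mono add_mono) auto
    finally show ?case
      using Z_le by (simp add: distrib_left)
  qed (simp add: B_def)
  then show ?thesis by (rule that)
qed

section \<open>Dyadic left sums as a function of the upper limit\<close>

text \<open>
  The integral over \<open>[0, x]\<close>, with respect to \<open>g\<close>, of the step function that takes on each cell of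
  level \<open>n\<close> the value of \<open>f\<close> at its left end point.  Truncating with \<open>min\<close> makes it continuous in \<open>x\<close>.
\<close>

definition step_integral :: "(real \<Rightarrow> real) \<Rightarrow> (real \<Rightarrow> real) \<Rightarrow> nat \<Rightarrow> real \<Rightarrow> real" where
  "step_integral f g n x =
     (\<Sum>k<2 ^ n. f (dyadic_point n k) * (g (min x (dyadic_point n (Suc k))) - g (min x (dyadic_point n k))))"

definition refinement_step :: "(real \<Rightarrow> real) \<Rightarrow> (real \<Rightarrow> real) \<Rightarrow> nat \<Rightarrow> real \<Rightarrow> real" where
  "refinement_step f g n x = step_integral f g (Suc n) x - step_integral f g n x"

definition refinement_error :: "(real \<Rightarrow> real) \<Rightarrow> (real \<Rightarrow> real) \<Rightarrow> nat \<Rightarrow> real" where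
  "refinement_error f g n =
     (\<Sum>k<2 ^ n. \<bar>increment f (Suc n) (2 * k) * increment g (Suc n) (Suc (2 * k))\<bar>)"

text \<open>
  Between two points of one cell the step function is constant, so only that cell contributes.
\<close>

lemma step_integral_within_cell:
  assumes k: "k < 2 ^ n"
    and s: "dyadic_point n k \<le> s" "s \<le> dyadic_point n (Suc k)"
    and t: "dyadic_point n k \<le> t" "t \<le> dyadic_point n (Suc k)"
  shows "step_integral f g n t - step_integral f g n s = f (dyadic_point n k) * (g t - g s)"
proof -
  define d where "d j = f (dyadic_point n j) * (g (min t (dyadic_point n (Suc j))) - g (min t (dyadic_point n j)))
      - f (dyadic_point n j) * (g (min s (dyadic_point n (Suc j))) - g (min s (dyadic_point n j)))" for j
  have d_k: "d k = f (dyadic_point n k) * (g t - g s)"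
    using s t by (simp add: d_def min_absorb1 min_absorb2 algebra_simps)
  have d_other: "d j = 0" if "j \<noteq> k" for j
  proof (cases "j < k")
    case True
    then have "dyadic_point n j \<le> dyadic_point n k" "dyadic_point n (Suc j) \<le> dyadic_point n k"
      by simp_all
    then have "dyadic_point n j \<le> s" "dyadic_point n (Suc j) \<le> s" "dyadic_point n j \<le> t" "dyadic_point n (Suc j) \<le> t"
      using s t by linarith+
    then show ?thesis
      by (simp add: d_def min_absorb2)
  next
    case False
    then have "dyadic_point n (Suc k) \<le> dyadic_point n j" "dyadic_point n (Suc k) \<le> dyadic_point n (Suc j)"
      using that by simp_all
    then have "s \<le> dyadic_point n j" "s \<le> dyadic_point n (Suc j)" "t \<le> dyadic_point n j" "t \<le> dyadic_point n (Suc j)"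
      using s t by linarith+
    then show ?thesis
      by (simp add: d_def min_absorb1)
  qed
  have "step_integral f g n t - step_integral f g n s = (\<Sum>j<2 ^ n. d j)"
    unfolding step_integral_def d_def sum_subtractf ..
  also have "\<dots> = (\<Sum>j\<in>{k}. d j)"
    using k d_other by (intro sum.mono_neutral_right) auto
  finally show ?thesis
    by (simp add: d_k)
qed

lemma step_integral_0 [simp]: "step_integral f g n 0 = 0"
  by (simp add: step_integral_def min_absorb1)

lemma increment_step_integral:
  assumes "k < 2 ^ n"
  shows "increment (step_integral f g n) n k = f (dyadic_point n k) * increment g n k"
  unfolding increment_def Suc_eq_plus1[symmetric]
  using assms by (intro step_integral_within_cell) auto

lemma continuous_on_step_integral:
  assumes "continuous_on {0..1} g"
  shows "continuous_on {0..1} (step_integral f g n)"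
  unfolding step_integral_def
  by (intro continuous_intros continuous_on_compose2[OF assms]) auto

lemma dyadic_left_sum_eq_step_integral:
  assumes "t \<in> dyadic_grid n"
  shows "dyadic_left_sum n t f g = step_integral f g n t"
proof -
  obtain K where K: "K \<le> 2 ^ n" "t = dyadic_point n K"
    using assms by (auto simp: dyadic_grid_def)
  have "nat \<lfloor>2 ^ n * t\<rfloor> = K"
    by (simp add: K dyadic_point_def)
  then have "dyadic_left_sum n t f g = (\<Sum>k<K. f (dyadic_point n k) * increment g n k)"
    by (simp add: dyadic_left_sum_def increment_def)
  also have "\<dots> = (\<Sum>k<K. increment (step_integral f g n) n k)"
    using K by (intro sum.cong) (auto simp: increment_step_integral)
  also have "\<dots> = step_integral f g n t"
    by (simp add: increment_sum K)
  finally show ?thesis .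
qed

lemma second_difference_step_integral:
  assumes "k < 2 ^ n"
  shows "second_difference (step_integral f g n) n k = f (dyadic_point n k) * second_difference g n k"
proof -
  let ?P = "step_integral f g n" and ?m = "dyadic_point (Suc n) (Suc (2 * k))"
  have m: "dyadic_point n k \<le> ?m" "?m \<le> dyadic_point n (Suc k)"
    using dyadic_point_le_iff[of "Suc n" "2 * k" "Suc (2 * k)"]
      dyadic_point_le_iff[of "Suc n" "Suc (2 * k)" "Suc (Suc (2 * k))"] by (simp_all del: dyadic_point_le_iff)
  have "?P ?m - ?P (dyadic_point n k) = f (dyadic_point n k) * (g ?m - g (dyadic_point n k))"
    "?P (dyadic_point n (Suc k)) - ?P ?m = f (dyadic_point n k) * (g (dyadic_point n (Suc k)) - g ?m)"
    using assms m by (intro step_integral_within_cell; simp)+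
  then show ?thesis
    by (simp add: second_difference_def algebra_simps)
qed

text \<open>
  On the left half of a cell the step functions of levels \<open>n\<close> and \<open>n + 1\<close> agree.  On the right half
  (odd \<open>j\<close>) they differ by the increment of \<open>f\<close> over the left half, which has index \<open>j - 1\<close>.
\<close>

lemma refinement_step_within_half_cell:
  assumes j: "j < 2 ^ Suc n"
    and s: "dyadic_point (Suc n) j \<le> s" "s \<le> dyadic_point (Suc n) (Suc j)"
    and t: "dyadic_point (Suc n) j \<le> t" "t \<le> dyadic_point (Suc n) (Suc j)"
  shows "refinement_step f g n t - refinement_step f g n s
    = (if even j then 0 else increment f (Suc n) (j - 1)) * (g t - g s)"
proof -
  define k where "k = j div 2"
  have k: "k < 2 ^ n" using j by (simp add: k_def)
  have j_cases: "j = 2 * k \<or> j = Suc (2 * k)"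
    unfolding k_def by presburger
  have in_cell: "dyadic_point n k \<le> dyadic_point (Suc n) j" "dyadic_point (Suc n) (Suc j) \<le> dyadic_point n (Suc k)"
    using j_cases dyadic_point_le_iff[of "Suc n" "2 * k" j]
      dyadic_point_le_iff[of "Suc n" "Suc j" "Suc (Suc (2 * k))"] by (auto simp del: dyadic_point_le_iff)
  have "step_integral f g (Suc n) t - step_integral f g (Suc n) s = f (dyadic_point (Suc n) j) * (g t - g s)"
    using assms by (intro step_integral_within_cell)
  moreover have "step_integral f g n t - step_integral f g n s = f (dyadic_point n k) * (g t - g s)"
    using k s t in_cell by (intro step_integral_within_cell) linarith+
  ultimately have "refinement_step f g n t - refinement_step f g n s
      = (f (dyadic_point (Suc n) j) - f (dyadic_point n k)) * (g t - g s)"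
    by (simp add: refinement_step_def algebra_simps)
  then show ?thesis
    using j_cases by (auto simp: increment_def)
qed

lemma grid_variation_refinement_step:
  "grid_variation (refinement_step f g n) (Suc n) = refinement_error f g n"
proof -
  have "increment (refinement_step f g n) (Suc n) j
      = (if even j then 0 else increment f (Suc n) (j - 1)) * increment g (Suc n) j" if "j < 2 ^ Suc n" for j
    unfolding increment_def[of _ _ j] Suc_eq_plus1[symmetric]
    using that by (intro refinement_step_within_half_cell) auto
  then have "grid_variation (refinement_step f g n) (Suc n)
      = (\<Sum>j<2 ^ Suc n. \<bar>(if even j then 0 else increment f (Suc n) (j - 1)) * increment g (Suc n) j\<bar>)"
    unfolding grid_variation_def by (intro sum.cong) auto
  then show ?thesis
    unfolding refinement_error_def power_Suc sum_lessThan_double by simp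
qed

text \<open>
  Hoelder pairs the increments of \<open>f\<close> over the left halves with those of \<open>g\<close> over the right halves;
  each family is only half of all increments of level \<open>n + 1\<close>.
\<close>

lemma refinement_error_le:
  assumes "p > 1" "q > 1" "1 / p + 1 / q = 1"
  shows "refinement_error f g n \<le> grid_norm p f (Suc n) * grid_norm q g (Suc n)"
proof -
  have even_part: "lp_sum r {..<2 ^ n} (\<lambda>k. w (2 * k)) \<le> lp_sum r {..<2 ^ Suc n} w"
    and odd_part: "lp_sum r {..<2 ^ n} (\<lambda>k. w (Suc (2 * k))) \<le> lp_sum r {..<2 ^ Suc n} w"
    if "r > 1" for r and w :: "nat \<Rightarrow> real"
    unfolding lp_sum_def power_Suc sum_lessThan_double sum.distrib
    using that by (auto intro!: powr_mono2 sum_nonneg)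
  have "refinement_error f g n
      \<le> lp_sum p {..<2 ^ n} (\<lambda>k. increment f (Suc n) (2 * k)) * lp_sum q {..<2 ^ n} (\<lambda>k. increment g (Suc n) (Suc (2 * k)))"
    unfolding refinement_error_def using assms by (intro holder_lp_sum) auto
  also have "\<dots> \<le> grid_norm p f (Suc n) * grid_norm q g (Suc n)"
    using assms by (intro mult_mono even_part odd_part) auto
  finally show ?thesis .
qed

text \<open>
  Up to the last grid point before \<open>x\<close> the refinement step is a partial sum of the terms of the
  refinement error.  The part beyond that point lies in one half cell, where it is an increment of
  \<open>f\<close> times a difference of two values of \<open>g\<close>.
\<close>

lemma refinement_step_bound:
  assumes p: "p > 0" and x: "x \<in> {0..1}" and M: "\<And>y. y \<in> {0..1} \<Longrightarrow> \<bar>g y\<bar> \<le> M"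
  shows "\<bar>refinement_step f g n x\<bar> \<le> refinement_error f g n + grid_norm p f (Suc n) * (2 * M)"
proof -
  obtain j where j: "j < 2 ^ Suc n" "dyadic_point (Suc n) j \<le> x" "x \<le> dyadic_point (Suc n) (Suc j)"
    using dyadic_cell[OF x] by blast
  let ?D = "refinement_step f g n" and ?c = "if even j then 0 else increment f (Suc n) (j - 1)"
  let ?s = "dyadic_point (Suc n) j"
  have "\<bar>?D ?s - ?D 0\<bar> \<le> refinement_error f g n"
    unfolding grid_variation_refinement_step[symmetric] using j by (intro abs_diff_le_grid_variation) simp
  moreover have "?D 0 = 0"
    by (simp add: refinement_step_def)
  moreover have "\<bar>?D x - ?D ?s\<bar> \<le> grid_norm p f (Suc n) * (2 * M)"
  proof -
    have "?D x - ?D ?s = ?c * (g x - g ?s)"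
      using j by (intro refinement_step_within_half_cell) auto
    moreover have "\<bar>?c\<bar> \<le> grid_norm p f (Suc n)"
      using p j abs_le_lp_sum[of p "{..<2 ^ Suc n}" "j - 1" "increment f (Suc n)"] by auto
    moreover have "\<bar>g x - g ?s\<bar> \<le> 2 * M"
    proof -
      have "\<bar>g x\<bar> \<le> M" "\<bar>g ?s\<bar> \<le> M"
        using x j by (auto intro!: M)
      then show ?thesis by linarith
    qed
    ultimately show ?thesis
      unfolding abs_mult by (simp only: abs_mult) (intro mult_mono; simp)
  qed
  ultimately show ?thesis by linarith
qed

lemma step_integral_eq_sum:
  "step_integral f g n x = step_integral f g 0 x + (\<Sum>m<n. refinement_step f g m x)"
  by (induction n) (simp_all add: refinement_step_def)

text \<open>
  The refinement steps form a series dominated by a geometric one, so the M-test applies.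
\<close>

theorem step_integral_uniform_limit:
  assumes g: "continuous_on {0..1} g"
    and D: "\<And>n x. x \<in> {0..1} \<Longrightarrow> \<bar>refinement_step f g n x\<bar> \<le> K * r ^ n"
    and r: "0 \<le> r" "r < 1"
  obtains F where "continuous_on {0..1} F" "\<And>x. x \<in> {0..1} \<Longrightarrow> (\<lambda>n. step_integral f g n x) \<longlonglongrightarrow> F x"
proof -
  define G where "G x = (\<Sum>m. refinement_step f g m x)" for x
  have unif: "uniform_limit {0..1} (\<lambda>n x. \<Sum>m<n. refinement_step f g m x) G sequentially"
    unfolding G_def
  proof (rule Weierstrass_m_test)
    show "norm (refinement_step f g n x) \<le> K * r ^ n" if "x \<in> {0..1}" for n x
      using D[OF that] by simp
    show "summable (\<lambda>n. K * r ^ n)"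
      using r by (intro summable_mult summable_geometric) simp
  qed
  have "continuous_on {0..1} (\<lambda>x. \<Sum>m<n. refinement_step f g m x)" for n
    unfolding refinement_step_def
    by (intro continuous_on_sum continuous_on_diff continuous_on_step_integral[OF g])
  then have "continuous_on {0..1} G"
    by (intro uniform_limit_theorem[OF _ unif]) simp_all
  then have "continuous_on {0..1} (\<lambda>x. step_integral f g 0 x + G x)"
    by (intro continuous_on_add continuous_on_step_integral[OF g])
  moreover have "(\<lambda>n. step_integral f g n x) \<longlonglongrightarrow> step_integral f g 0 x + G x" if "x \<in> {0..1}" for x
  proof -
    have "(\<lambda>n. step_integral f g 0 x + (\<Sum>m<n. refinement_step f g m x))
        \<longlonglongrightarrow> step_integral f g 0 x + G x"
      using tendsto_uniform_limitI[OF unif that] by (intro tendsto_add tendsto_const)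
    then show ?thesis
      by (simp only: step_integral_eq_sum[symmetric])
  qed
  ultimately show ?thesis
    by (rule that)
qed

lemma dyadic_grid_mono:
  assumes "t \<in> dyadic_grid n"
  shows "t \<in> dyadic_grid (n + j)"
proof -
  obtain k where k: "k \<le> 2 ^ n" "t = dyadic_point n k"
    using assms by (auto simp: dyadic_grid_def)
  then have "t = dyadic_point (n + j) (k * 2 ^ j)" "k * 2 ^ j \<le> 2 ^ (n + j)"
    by (simp_all add: dyadic_point_def power_add)
  then show ?thesis
    unfolding dyadic_grid_def by (intro image_eqI[of _ _ "k * 2 ^ j"]) auto
qed

lemma dyadics_subset: "dyadics \<subseteq> {0..1}"
  by (auto simp: dyadics_def dyadic_grid_def)

lemma closure_dyadics: "closure dyadics = {0..1}"
proof -
  have "dyadics = {0..1} \<inter> (\<Union>k m. {of_nat m / 2 ^ k})"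
    using dyadics_subset
    by (force simp: dyadics_def dyadic_grid_def dyadic_point_def divide_le_eq)
  then show ?thesis
    using closure_dyadic_rationals_in_convex_set_pos_1[of "{0..1}"] by simp
qed

lemma dyadic_left_sums_tendsto:
  assumes t: "t \<in> dyadics" and lim: "(\<lambda>n. step_integral f g n t) \<longlonglongrightarrow> l"
  shows "(\<lambda>j. dyadic_left_sum (dyadic_level t + j) t f g) \<longlonglongrightarrow> l"
proof -
  have "t \<in> dyadic_grid (dyadic_level t)"
    using t unfolding dyadic_level_def dyadics_def by (auto intro: LeastI)
  then have "dyadic_left_sum (dyadic_level t + j) t f g = step_integral f g (j + dyadic_level t) t" for j
    unfolding add.commute[of j] by (intro dyadic_left_sum_eq_step_integral dyadic_grid_mono)
  then show ?thesis
    using LIMSEQ_ignore_initial_segment[OF lim, of "dyadic_level t"] by simp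
qed

text \<open>
  The left sums at a dyadic \<open>t\<close> are eventually values of the step integrals at \<open>t\<close>.  A continuous
  function is determined by its values on the dense set of dyadic points, which settles the
  uniqueness hidden in the definite description.
\<close>

lemma faber_schauder_integral_eqI:
  assumes F: "continuous_on {0..1} F"
    and lim: "\<And>x. x \<in> {0..1} \<Longrightarrow> (\<lambda>n. step_integral f g n x) \<longlonglongrightarrow> F x"
  shows "faber_schauder_integral_exists f g"
    and "faber_schauder_integral f g = restrict F {0..1}"
proof -
  have sums: "(\<lambda>j. dyadic_left_sum (dyadic_level t + j) t f g) \<longlonglongrightarrow> F t" if "t \<in> dyadics" for t
    using that dyadics_subset by (intro dyadic_left_sums_tendsto lim) auto
  then have F_eq: "F t = dyadic_integral f g t" if "t \<in> dyadics" for t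
    unfolding dyadic_integral_def using limI[OF sums[OF that]] by simp
  show "faber_schauder_integral_exists f g"
    unfolding faber_schauder_integral_exists_def dyadic_integral_exists_def
    using F F_eq sums by (auto simp: convergent_def)
  show "faber_schauder_integral f g = restrict F {0..1}"
    unfolding faber_schauder_integral_def
  proof (rule the_equality)
    show "continuous_on {0..1} (restrict F {0..1}) \<and> restrict F {0..1} \<in> extensional {0..1} \<and>
        (\<forall>t\<in>dyadics. restrict F {0..1} t = dyadic_integral f g t)"
    proof (intro conjI ballI)
      show "continuous_on {0..1} (restrict F {0..1})"
        using F by (rule continuous_on_eq) simp
      show "restrict F {0..1} t = dyadic_integral f g t" if "t \<in> dyadics" for t
        using that dyadics_subset F_eq by auto
    qed simp
  next
    fix G assume G: "continuous_on {0..1} G \<and> G \<in> extensional {0..1} \<and>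
        (\<forall>t\<in>dyadics. G t = dyadic_integral f g t)"
    have "continuous_on (closure dyadics) (\<lambda>x. G x - F x)"
      unfolding closure_dyadics using G F by (intro continuous_on_diff) auto
    moreover have "G t - F t = 0" if "t \<in> dyadics" for t
      using G F_eq that by simp
    ultimately have "G x - F x = 0" if "x \<in> {0..1}" for x
      by (rule continuous_constant_on_closure) (use that closure_dyadics in simp_all)
    then show "G = restrict F {0..1}"
      using G by (intro extensionalityI[of _ "{0..1}"]) auto
  qed
qed

text \<open>
  The refinement step at level \<open>l\<close> has variation \<open>refinement_error f g l\<close> along the grid of level
  \<open>l + 1\<close>, hence at most that along the coarser grid of level \<open>n + 1\<close>.
\<close>

lemma grid_variation_step_integral_diff:
  assumes "n \<le> m"
  shows "grid_variation (\<lambda>x. step_integral f g m x - step_integral f g n x) (Suc n)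
    \<le> (\<Sum>l\<in>{n..<m}. refinement_error f g l)"
  using assms
proof (induction m rule: dec_induct)
  case base
  then show ?case by (simp add: grid_variation_def increment_def)
next
  case (step m)
  have "grid_variation (\<lambda>x. step_integral f g (Suc m) x - step_integral f g n x) (Suc n)
      = grid_variation (\<lambda>x. (step_integral f g m x - step_integral f g n x) + refinement_step f g m x) (Suc n)"
    by (simp add: refinement_step_def)
  also have "\<dots> \<le> grid_variation (\<lambda>x. step_integral f g m x - step_integral f g n x) (Suc n)
      + grid_variation (refinement_step f g m) (Suc n)"
    by (rule grid_variation_add)
  also have "grid_variation (refinement_step f g m) (Suc n) \<le> refinement_error f g m"
    unfolding grid_variation_refinement_step[symmetric] using step by (intro grid_variation_mono) simp
  finally show ?case
    using step by simp
qed

text \<open>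
  The difference inside the absolute value is the second difference of the remainder
  \<open>F - step_integral f g n\<close>.  Its sum is at most the variation of the remainder along the grid of
  level \<open>n + 1\<close>, which is a limit of quantities bounded by tails of a geometric series.
\<close>

theorem sum_abs_second_difference_integral:
  assumes lim: "\<And>x. x \<in> {0..1} \<Longrightarrow> (\<lambda>n. step_integral f g n x) \<longlonglongrightarrow> F x"
    and E: "\<And>n. refinement_error f g n \<le> K * r ^ n"
    and r: "0 \<le> r" "r < 1" and K: "0 \<le> K"
  shows "(\<Sum>k<2 ^ n. \<bar>second_difference F n k - f (dyadic_point n k) * second_difference g n k\<bar>)
    \<le> K / (1 - r) * r ^ n"
proof -
  let ?R = "\<lambda>x. F x - step_integral f g n x"
  have "second_difference F n k - f (dyadic_point n k) * second_difference g n k = second_difference ?R n k"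
    if "k < 2 ^ n" for k
    unfolding second_difference_step_integral[OF that, symmetric] by (simp add: second_difference_def)
  then have "(\<Sum>k<2 ^ n. \<bar>second_difference F n k - f (dyadic_point n k) * second_difference g n k\<bar>)
      = (\<Sum>k<2 ^ n. \<bar>second_difference ?R n k\<bar>)"
    by simp
  also have "\<dots> \<le> grid_variation ?R (Suc n)"
    by (rule sum_abs_second_difference_le)
  also have "\<dots> \<le> K / (1 - r) * r ^ n"
  proof (rule LIMSEQ_le_const2)
    show "(\<lambda>m. grid_variation (\<lambda>x. step_integral f g m x - step_integral f g n x) (Suc n))
        \<longlonglongrightarrow> grid_variation ?R (Suc n)"
      unfolding grid_variation_def increment_def Suc_eq_plus1[symmetric]
      by (intro tendsto_sum tendsto_rabs tendsto_diff tendsto_const lim)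
        (auto simp del: power_Suc)
    have "(\<Sum>l\<in>{n..<m}. refinement_error f g l) \<le> K / (1 - r) * r ^ n" if "n \<le> m" for m
    proof -
      have "(\<Sum>l\<in>{n..<m}. refinement_error f g l) \<le> (\<Sum>l\<in>{n..<m}. K * r ^ l)"
        by (intro sum_mono E)
      also have "\<dots> = K * ((r ^ n - r ^ m) / (1 - r))"
        using sum_gp_strict[of r n] sum_gp_strict[of r m] r that
        by (simp add: sum_distrib_left[symmetric] sum_diff_nat_ivl[of 0 n m "\<lambda>i. r ^ i", symmetric, simplified lessThan_atLeast0[symmetric]] diff_divide_distrib)
      also have "\<dots> \<le> K * (r ^ n / (1 - r))"
        using r K by (intro mult_left_mono divide_right_mono) auto
      finally show ?thesis by simp
    qed
    then show "\<exists>N. \<forall>m\<ge>N. grid_variation (\<lambda>x. step_integral f g m x - step_integral f g n x) (Suc n)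
        \<le> K / (1 - r) * r ^ n"
      using grid_variation_step_integral_diff[of n _ f g] by (meson order_trans)
  qed
  finally show ?thesis .
qed

section \<open>Extended nonnegative sequence norms\<close>

lemma ennreal_summable_on [simp]:
  fixes f :: "'i \<Rightarrow> ennreal"
  shows "f summable_on J"
  by (rule nonneg_summable_on_complete) simp

lemma infsum_ennreal_le:
  fixes f :: "'i \<Rightarrow> ennreal"
  assumes "\<And>F. finite F \<Longrightarrow> F \<subseteq> J \<Longrightarrow> sum f F \<le> B"
  shows "infsum f J \<le> B"
  unfolding nonneg_infsum_complete[OF zero_le] using assms by (intro SUP_least) auto

lemma infsum_ennreal_cmult:
  fixes f :: "'i \<Rightarrow> ennreal"
  shows "infsum (\<lambda>i. c * f i) J = c * infsum f J"
  by (simp add: nonneg_infsum_complete SUP_mult_left_ennreal flip: sum_distrib_left)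

lemma ennreal_powr_ennreal [simp]: "0 \<le> x \<Longrightarrow> ennreal_powr (ennreal x) p = ennreal (x powr p)"
  by (simp add: ennreal_powr_def)

lemma ennreal_powr_top [simp]: "ennreal_powr top p = top"
  by (simp add: ennreal_powr_def)

lemma ennreal_powr_mono:
  assumes "p > 0" "x \<le> y"
  shows "ennreal_powr x p \<le> ennreal_powr y p"
  using assms
  by (cases x; cases y) (auto simp: top_unique intro!: ennreal_leI powr_mono2)

lemma ennreal_powr_inverse:
  assumes "p > 0"
  shows "ennreal_powr (ennreal_powr x p) (1 / p) = x"
  using assms by (cases x) (auto simp: powr_powr)

lemma ennreal_powr_cmult:
  assumes "c \<ge> 0"
  shows "ennreal_powr (ennreal c * x) p = ennreal (c powr p) * ennreal_powr x p"
proof (cases x)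
  case (real a)
  then show ?thesis
    using assms by (simp add: powr_mult flip: ennreal_mult)
next
  case top
  then show ?thesis
    using assms ennreal_powr_ennreal[of 0 p] by (cases "c = 0") (auto simp: ennreal_mult_top)
qed

lemma lp_norm_on_finite_iff:
  "lp_norm_on p J a < \<infinity> \<longleftrightarrow> (\<Sum>\<^sub>\<infinity>n\<in>J. ennreal_powr (a n) p) < \<infinity>"
  by (simp add: lp_norm_on_def ennreal_powr_def less_top)

lemma le_lp_norm_on:
  assumes "p > 0" "n \<in> J"
  shows "a n \<le> lp_norm_on p J a"
proof -
  have "ennreal_powr (a n) p \<le> (\<Sum>\<^sub>\<infinity>n\<in>J. ennreal_powr (a n) p)"
    unfolding nonneg_infsum_complete[OF zero_le] using assms(2) by (intro SUP_upper2[of "{n}"]) auto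
  then have "ennreal_powr (ennreal_powr (a n) p) (1 / p) \<le> lp_norm_on p J a"
    unfolding lp_norm_on_def using assms by (intro ennreal_powr_mono) auto
  then show ?thesis
    using assms by (simp add: ennreal_powr_inverse)
qed

lemma lp_norm_on_finite_mono:
  assumes "p > 0" "\<And>n. n \<in> J \<Longrightarrow> a n \<le> b n" "lp_norm_on p J b < \<infinity>"
  shows "lp_norm_on p J a < \<infinity>"
  using assms(3) unfolding lp_norm_on_finite_iff
  by (rule le_less_trans[rotated]) (use assms(1,2) in \<open>intro infsum_mono ennreal_powr_mono; simp\<close>)

lemma lp_norm_on_finite_cmult:
  assumes "c \<ge> 0" "lp_norm_on p J a < \<infinity>"
  shows "lp_norm_on p J (\<lambda>n. ennreal c * a n) < \<infinity>"
  using assms unfolding lp_norm_on_finite_iff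
  by (simp add: ennreal_powr_cmult infsum_ennreal_cmult ennreal_mult_less_top)

text \<open>
  The crude bound \<open>x + y \<le> 2 * max x y\<close> is enough for finiteness and also covers infinite entries.
\<close>

lemma lp_norm_on_finite_add:
  assumes p: "p > 0" and a: "lp_norm_on p J a < \<infinity>" and b: "lp_norm_on p J b < \<infinity>"
  shows "lp_norm_on p J (\<lambda>n. a n + b n) < \<infinity>"
proof -
  have pointwise: "ennreal_powr (x + y) p \<le> ennreal_powr (ennreal 2 * x) p + ennreal_powr (ennreal 2 * y) p" for x y
  proof (cases "x \<le> y")
    case True
    then have "x + y \<le> ennreal 2 * y"
      by (simp add: mult_2 add_right_mono)
    then show ?thesis
      using ennreal_powr_mono[OF p] by (simp add: add_increasing)
  next
    case False
    then have "x + y \<le> ennreal 2 * x"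
      by (simp add: mult_2 add_left_mono)
    then show ?thesis
      using ennreal_powr_mono[OF p] by (simp add: add_increasing2)
  qed
  have "(\<Sum>\<^sub>\<infinity>n\<in>J. ennreal_powr (a n + b n) p)
      \<le> (\<Sum>\<^sub>\<infinity>n\<in>J. ennreal_powr (ennreal 2 * a n) p + ennreal_powr (ennreal 2 * b n) p)"
    by (intro infsum_mono pointwise ennreal_summable_on)
  also have "\<dots> = (\<Sum>\<^sub>\<infinity>n\<in>J. ennreal_powr (ennreal 2 * a n) p) + (\<Sum>\<^sub>\<infinity>n\<in>J. ennreal_powr (ennreal 2 * b n) p)"
    by (intro infsum_add ennreal_summable_on)
  also have "\<dots> < \<infinity>"
    using lp_norm_on_finite_cmult[OF _ a, of 2] lp_norm_on_finite_cmult[OF _ b, of 2]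
    unfolding lp_norm_on_finite_iff by simp
  finally show ?thesis
    unfolding lp_norm_on_finite_iff .
qed

lemma infsum_geometric_le:
  assumes r: "0 \<le> r" "r < 1" and K: "0 \<le> K"
  shows "(\<Sum>\<^sub>\<infinity>m\<in>{n..}. ennreal (K * r ^ m)) \<le> ennreal (K / (1 - r) * r ^ n)"
proof (rule infsum_ennreal_le)
  fix F assume F: "finite F" "F \<subseteq> {n..}"
  have "(\<Sum>m\<in>F. r ^ m) = (\<Sum>m\<in>(\<lambda>m. m - n) ` F. r ^ n * r ^ m)"
  proof -
    have "inj_on (\<lambda>m. m - n) F"
      using F(2) by (intro inj_onI) (metis atLeast_iff le_add_diff_inverse subsetD)
    then show ?thesis
      using F by (subst sum.reindex) (auto intro!: sum.cong simp: subset_eq o_def simp flip: power_add)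
  qed
  also have "\<dots> \<le> r ^ n * (1 / (1 - r))"
    unfolding sum_distrib_left[symmetric]
    using r F sum_le_suminf[of "\<lambda>m. r ^ m" "(\<lambda>m. m - n) ` F"]
    by (intro mult_left_mono) (auto simp: suminf_geometric)
  finally have "K * (\<Sum>m\<in>F. r ^ m) \<le> K * (r ^ n * (1 / (1 - r)))"
    using K by (intro mult_left_mono)
  then show "(\<Sum>m\<in>F. ennreal (K * r ^ m)) \<le> ennreal (K / (1 - r) * r ^ n)"
    using r K by (auto intro!: ennreal_leI simp: sum_distrib_left mult_ac)
qed

lemma lp_norm_on_geometric:
  assumes p: "p > 0" and r: "0 \<le> r" "r < 1" and K: "0 \<le> K"
  shows "lp_norm_on p {0::nat..} (\<lambda>n. ennreal (K * r ^ n)) < \<infinity>"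
proof -
  have "(r ^ n) powr p = (r powr p) ^ n" for n
    using r by (induction n) (simp_all add: powr_mult)
  then have "ennreal_powr (ennreal (K * r ^ n)) p = ennreal (K powr p * (r powr p) ^ n)" for n
    using r K by (simp add: powr_mult)
  moreover have "(\<Sum>\<^sub>\<infinity>n\<in>{0..}. ennreal (K powr p * (r powr p) ^ n))
      \<le> ennreal (K powr p / (1 - r powr p) * (r powr p) ^ 0)"
    using p r powr_less_mono2[of p r 1] by (intro infsum_geometric_le) auto
  ultimately show ?thesis
    unfolding lp_norm_on_finite_iff by (simp add: le_less_trans less_top)
qed

text \<open>
  Separates the affine level \<open>-1\<close>, so that the remaining levels can be indexed by natural numbers.
\<close>

lemma lp_norm_on_levels_finite_iff:
  fixes a :: "int \<Rightarrow> ennreal"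
  shows "lp_norm_on p {-1..} a < \<infinity> \<longleftrightarrow> a (- 1) < \<infinity> \<and> lp_norm_on p {0::nat..} (\<lambda>n. a (int n)) < \<infinity>"
proof -
  have levels: "{-1..} = insert (- 1) (int ` {0..})"
  proof (intro equalityI subsetI)
    fix n :: int assume "n \<in> {-1..}"
    then have "n = - 1 \<or> n = int (nat n)" by auto
    then show "n \<in> insert (- 1) (int ` {0..})" by (metis UNIV_I atLeast_0 imageI insertCI)
  qed auto
  have "(\<Sum>\<^sub>\<infinity>n\<in>{-1..}. ennreal_powr (a n) p)
      = ennreal_powr (a (- 1)) p + (\<Sum>\<^sub>\<infinity>n\<in>int ` {0..}. ennreal_powr (a n) p)"
    unfolding levels by (intro infsum_insert) auto
  also have "(\<Sum>\<^sub>\<infinity>n\<in>int ` {0..}. ennreal_powr (a n) p) = (\<Sum>\<^sub>\<infinity>n\<in>{0..}. ennreal_powr (a (int n)) p)"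
    by (subst infsum_reindex) (auto simp: o_def)
  finally show ?thesis
    unfolding lp_norm_on_finite_iff by (simp add: ennreal_powr_def less_top)
qed

section \<open>The energy space\<close>

text \<open>
  The term of index \<open>m\<close> in the Schauder tail series, equal to the largest modulus of a second
  difference of level \<open>m\<close>; the next two lemmas say so.
\<close>

abbreviation sup_coeff :: "(real \<Rightarrow> real) \<Rightarrow> nat \<Rightarrow> real" where
  "sup_coeff h m \<equiv> 2 powr (- real m / 2) * (SUP k\<in>{..<2 ^ m}. \<bar>fs_coeff h (int m) k\<bar>)"

lemma abs_second_difference_le_sup_coeff:
  assumes "k < 2 ^ m"
  shows "\<bar>second_difference h m k\<bar> \<le> sup_coeff h m"
proof -
  have "\<bar>fs_coeff h (int m) k\<bar> \<le> (SUP k\<in>{..<2 ^ m}. \<bar>fs_coeff h (int m) k\<bar>)"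
    using assms by (intro cSUP_upper) auto
  then have "2 powr (- real m / 2) * \<bar>fs_coeff h (int m) k\<bar> \<le> sup_coeff h m"
    by (intro mult_left_mono) auto
  then show ?thesis
    by (simp add: fs_coeff_eq_second_difference abs_mult flip: mult.assoc powr_add)
qed

lemma sup_coeff_least:
  assumes "\<And>k. k < 2 ^ m \<Longrightarrow> \<bar>second_difference h m k\<bar> \<le> c"
  shows "sup_coeff h m \<le> c"
proof -
  have "(SUP k\<in>{..<2 ^ m}. \<bar>fs_coeff h (int m) k\<bar>) \<le> 2 powr (real m / 2) * c"
    using assms by (intro cSUP_least) (auto simp: lessThan_empty_iff fs_coeff_eq_second_difference abs_mult)
  then have "sup_coeff h m \<le> 2 powr (- real m / 2) * (2 powr (real m / 2) * c)"
    by (intro mult_left_mono) auto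
  then show ?thesis
    by (simp flip: mult.assoc powr_add)
qed

lemma energy_space_finite_norms:
  assumes "h \<in> energy_space p"
  shows "lp_norm_on p {-1..} (\<lambda>n. ennreal (level_energy p h n)) < \<infinity>"
    and "lp_norm_on p {0..} (schauder_tail h) < \<infinity>"
  using assms unfolding energy_space_def energy_norm_def by auto

text \<open>
  If the second differences of \<open>I\<close> are those of \<open>g\<close> times bounded factors, up to an error whose sum
  over each level decays geometrically, then at levels \<open>n \<ge> 0\<close> both sequences in the energy norm of
  \<open>I\<close> are dominated by \<open>M\<close> times those of \<open>g\<close> plus a geometric sequence.  The \<open>\<ell>\<^sup>1\<close> bound on the error controls its \<open>\<ell>\<^sup>q\<close>
  norm for the energies and its supremum for the tails.
\<close>

lemma energy_spaceI_second_difference: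
  assumes q: "q > 1"
    and g: "g \<in> energy_space q"
    and I: "continuous_on {0..1} I"
    and f: "\<And>x. x \<in> {0..1} \<Longrightarrow> \<bar>f x\<bar> \<le> M"
    and near: "\<And>n. (\<Sum>k<2 ^ n. \<bar>second_difference I n k - f (dyadic_point n k) * second_difference g n k\<bar>) \<le> K * r ^ n"
    and r: "0 \<le> r" "r < 1" and K: "0 \<le> K"
  shows "I \<in> energy_space q"
proof -
  have M: "0 \<le> M"
    using f[of 0] by simp
  note energies_g = energy_space_finite_norms(1)[OF g] and tails_g = energy_space_finite_norms(2)[OF g]
  let ?e = "\<lambda>n k. second_difference I n k - f (dyadic_point n k) * second_difference g n k"
  have scaled: "\<bar>f (dyadic_point n k) * second_difference g n k\<bar> \<le> \<bar>M * second_difference g n k\<bar>"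
    if "k < 2 ^ n" for n k
    using that M f[of "dyadic_point n k"] by (simp add: abs_mult mult_right_mono)

  have level: "level_energy q I (int n) \<le> M * level_energy q g (int n) + K * r ^ n" for n
  proof -
    have "level_energy q I (int n) = lp_sum q {..<2 ^ n} (\<lambda>k. f (dyadic_point n k) * second_difference g n k + ?e n k)"
      using q by (simp add: level_energy_eq_lp_sum)
    also have "\<dots> \<le> lp_sum q {..<2 ^ n} (\<lambda>k. f (dyadic_point n k) * second_difference g n k) + lp_sum q {..<2 ^ n} (?e n)"
      using q by (intro minkowski_lp_sum) auto
    also have "\<dots> \<le> lp_sum q {..<2 ^ n} (\<lambda>k. M * second_difference g n k) + K * r ^ n"
      using q scaled order_trans[OF lp_sum_le_sum_abs near]
      by (intro add_mono lp_sum_mono) auto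
    also have "lp_sum q {..<2 ^ n} (\<lambda>k. M * second_difference g n k) = M * level_energy q g (int n)"
      using q M by (simp add: lp_sum_scale level_energy_eq_lp_sum)
    finally show ?thesis .
  qed
  have energies_I: "lp_norm_on q {-1..} (\<lambda>n. ennreal (level_energy q I n)) < \<infinity>"
    unfolding lp_norm_on_levels_finite_iff
  proof
    have "lp_norm_on q {0..} (\<lambda>n. ennreal M * ennreal (level_energy q g (int n)) + ennreal (K * r ^ n)) < \<infinity>"
      using energies_g q r K M unfolding lp_norm_on_levels_finite_iff
      by (intro lp_norm_on_finite_add lp_norm_on_finite_cmult lp_norm_on_geometric) auto
    then show "lp_norm_on q {0..} (\<lambda>n. ennreal (level_energy q I (int n))) < \<infinity>"
      by (rule lp_norm_on_finite_mono[rotated 2])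
        (use q r K M level level_energy_nonneg in \<open>auto simp flip: ennreal_plus ennreal_mult intro!: ennreal_leI\<close>)
  qed simp

  have sup: "sup_coeff I m \<le> M * sup_coeff g m + K * r ^ m" for m
  proof (rule sup_coeff_least)
    fix k :: nat assume k: "k < 2 ^ m"
    have "\<bar>?e m k\<bar> \<le> (\<Sum>k<2 ^ m. \<bar>?e m k\<bar>)"
      using k by (intro member_le_sum) auto
    also have "\<dots> \<le> K * r ^ m" by (rule near)
    finally have "\<bar>?e m k\<bar> \<le> K * r ^ m" .
    moreover have "\<bar>M * second_difference g m k\<bar> \<le> M * sup_coeff g m"
      using M abs_second_difference_le_sup_coeff[OF k, of g] by (simp only: abs_mult abs_of_nonneg mult_left_mono)
    ultimately show "\<bar>second_difference I m k\<bar> \<le> M * sup_coeff g m + K * r ^ m"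
      using scaled[OF k] by linarith
  qed
  have tail: "schauder_tail I n \<le> ennreal M * schauder_tail g n + ennreal (K / (1 - r) * r ^ n)" for n
  proof -
    have sup_g: "0 \<le> sup_coeff g m" for m
      using abs_second_difference_le_sup_coeff[of 0 m g] by (rule order_trans[rotated]) auto
    have "schauder_tail I n \<le> (\<Sum>\<^sub>\<infinity>m\<in>{n..}. ennreal M * ennreal (sup_coeff g m) + ennreal (K * r ^ m))"
      unfolding schauder_tail_def
      using sup sup_g M K r
      by (intro infsum_mono ennreal_summable_on) (auto simp flip: ennreal_plus ennreal_mult intro!: ennreal_leI)
    also have "\<dots> = ennreal M * schauder_tail g n + (\<Sum>\<^sub>\<infinity>m\<in>{n..}. ennreal (K * r ^ m))"
      unfolding schauder_tail_def by (simp add: infsum_add infsum_ennreal_cmult)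
    also have "\<dots> \<le> ennreal M * schauder_tail g n + ennreal (K / (1 - r) * r ^ n)"
      using r K by (intro add_left_mono infsum_geometric_le)
    finally show ?thesis .
  qed
  have "lp_norm_on q {0..} (\<lambda>n. ennreal M * schauder_tail g n + ennreal (K / (1 - r) * r ^ n)) < \<infinity>"
    using tails_g q r K M
    by (intro lp_norm_on_finite_add lp_norm_on_finite_cmult lp_norm_on_geometric) auto
  then have tails_I: "lp_norm_on q {0..} (schauder_tail I) < \<infinity>"
    by (rule lp_norm_on_finite_mono[rotated 2]) (use q tail in auto)

  have "bounded (I ` {0..1})"
    using I by (intro compact_imp_bounded compact_continuous_image) auto
  then obtain b where "\<forall>y\<in>I ` {0..1}. norm y \<le> b"
    unfolding bounded_iff by blast
  then have "(SUP x\<in>{0..1}. ennreal \<bar>I x\<bar>) \<le> ennreal b"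
    by (intro SUP_least ennreal_leI) auto
  also have "\<dots> < \<infinity>" by simp
  finally show ?thesis
    using I energies_I tails_I
    unfolding energy_space_def energy_norm_def by (auto simp: less_top)
qed

text \<open>
  A single entry of the accumulated energies, namely the first one of the tail, already bounds the
  increments of the next level.
\<close>

lemma grid_norm_le_tail_functional:
  assumes "p \<ge> 1"
  shows "ennreal (grid_norm p h (Suc n)) \<le> tail_functional p h n"
proof -
  have "0 \<le> accumulated_energy p h n"
    unfolding accumulated_energy_def by (intro sum_nonneg mult_nonneg_nonneg level_energy_nonneg) simp
  moreover have "2 powr (- (1 - 1 / p)) \<le> 1"
    using powr_mono[of "- (1 - 1 / p)" 0 2] assms by simp
  ultimately have "2 powr (- (1 - 1 / p)) * accumulated_energy p h n \<le> accumulated_energy p h n"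
    using mult_right_mono by fastforce
  then have "ennreal (grid_norm p h (Suc n)) \<le> ennreal (accumulated_energy p h n)"
    using grid_norm_le_accumulated_energy[OF assms, where h = h and n = n] by (intro ennreal_leI) linarith
  also have "\<dots> \<le> lp_norm_on p {n..} (\<lambda>n. ennreal (accumulated_energy p h n))"
    using assms by (intro le_lp_norm_on) auto
  also have "\<dots> \<le> tail_functional p h n"
    unfolding tail_functional_def by simp
  finally show ?thesis .
qed

lemma energy_space_grid_norm_bounded:
  assumes "p > 1" "h \<in> energy_space p"
  obtains B where "\<And>n. grid_norm p h n \<le> B"
proof -
  let ?Z = "lp_norm_on p {-1..} (\<lambda>n. ennreal (level_energy p h n))"
  have "?Z < \<infinity>"
    using energy_space_finite_norms(1)[OF assms(2)] .
  then obtain Z where Z: "0 \<le> Z" "?Z = ennreal Z"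
    by (cases ?Z) auto
  have "level_energy p h (int n) \<le> Z" for n
    using le_lp_norm_on[of p "int n" "{-1..}" "\<lambda>n. ennreal (level_energy p h n)"] Z assms(1)
    by simp
  then show ?thesis
    using grid_norm_bounded[OF assms(1)] that by blast
qed

theorem theorem3p29:
  fixes p q C \<rho> :: real and f g :: "real \<Rightarrow> real"
  assumes "p > 1" and "q > 1" and "1 / p + 1 / q = 1"
    and "f \<in> energy_space p" and "g \<in> energy_space q"
    and "C > 0" and "\<rho> > 0"
    and "\<And>N. tail_functional p f N \<le> ennreal (C * 2 powr (- \<rho> * real N))"
  shows "faber_schauder_integral_exists f g \<and> faber_schauder_integral f g \<in> energy_space q"
proof -
  define r where "r = 2 powr (- \<rho>)"
  have r: "0 < r" "r < 1"
    using assms(7) by (auto simp: r_def powr_less_one)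
  have f: "continuous_on {0..1} f" and g: "continuous_on {0..1} g"
    using assms(4,5) by (auto simp: energy_space_def)
  have "bounded (f ` {0..1} \<union> g ` {0..1})"
    using f g by (intro compact_imp_bounded compact_Un compact_continuous_image) auto
  then obtain M where "\<forall>y\<in>f ` {0..1} \<union> g ` {0..1}. norm y \<le> M"
    unfolding bounded_iff by blast
  then have M: "\<And>x. x \<in> {0..1} \<Longrightarrow> \<bar>f x\<bar> \<le> M" "\<And>x. x \<in> {0..1} \<Longrightarrow> \<bar>g x\<bar> \<le> M"
    by auto

  have norm_f: "grid_norm p f (Suc n) \<le> C * r ^ n" for n
  proof -
    have "ennreal (grid_norm p f (Suc n)) \<le> ennreal (C * 2 powr (- \<rho> * real n))"
      using grid_norm_le_tail_functional[where p = p and h = f and n = n] assms(1,8)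
      by (meson order_trans less_imp_le)
    also have "2 powr (- \<rho> * real n) = r ^ n"
      by (simp add: r_def powr_power mult.commute)
    finally show ?thesis
      using r assms(6) by (simp add: ennreal_le_iff)
  qed
  obtain B where B: "\<And>n. grid_norm q g n \<le> B"
    using energy_space_grid_norm_bounded[OF assms(2,5)] by blast
  have B0: "0 \<le> B"
    using B[of 0] by (rule order_trans[rotated]) simp

  have E: "refinement_error f g n \<le> C * B * r ^ n" for n
  proof -
    have "refinement_error f g n \<le> grid_norm p f (Suc n) * grid_norm q g (Suc n)"
      by (rule refinement_error_le[OF assms(1-3)])
    also have "\<dots> \<le> (C * r ^ n) * B"
      by (rule mult_mono[OF norm_f B]) (use r assms(6) in auto)
    finally show ?thesis by (simp add: mult_ac)
  qed
  have D: "\<bar>refinement_step f g n x\<bar> \<le> (C * (B + 2 * M)) * r ^ n" if "x \<in> {0..1}" for n x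
  proof -
    have "\<bar>refinement_step f g n x\<bar> \<le> refinement_error f g n + grid_norm p f (Suc n) * (2 * M)"
      using assms(1) that M by (intro refinement_step_bound) auto
    also have "\<dots> \<le> C * B * r ^ n + C * r ^ n * (2 * M)"
      using E norm_f M(1)[of 0] by (intro add_mono mult_right_mono) auto
    finally show ?thesis by (simp add: algebra_simps)
  qed
  obtain F where F: "continuous_on {0..1} F"
      "\<And>x. x \<in> {0..1} \<Longrightarrow> (\<lambda>n. step_integral f g n x) \<longlonglongrightarrow> F x"
    using step_integral_uniform_limit[OF g D] r by (metis less_imp_le)
  \<comment> \<open>\<open>F\<close> is arbitrary outside the unit interval; the integral is the extensional version.\<close>
  define I where "I = restrict F {0..1}"
  have I: "continuous_on {0..1} I" "\<And>x. x \<in> {0..1} \<Longrightarrow> (\<lambda>n. step_integral f g n x) \<longlonglongrightarrow> I x"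
    using F by (auto simp: I_def intro: continuous_on_eq)
  have "(\<Sum>k<2 ^ n. \<bar>second_difference I n k - f (dyadic_point n k) * second_difference g n k\<bar>)
      \<le> C * B / (1 - r) * r ^ n" for n
    using I(2) E r B0 assms(6) by (intro sum_abs_second_difference_integral) auto
  from energy_spaceI_second_difference[OF assms(2,5) I(1) M(1) this] have "I \<in> energy_space q"
    using r B0 assms(6) by simp
  then show ?thesis
    using faber_schauder_integral_eqI[OF F] by (simp add: I_def)
qed

end
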